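(* Let $\mathcal{A},\mathcal{B}$ be finite non-empty alphabets. For any invariant measure $\mu$ on the full shift $\mathcal{A}^{\mathbb{Z}}$ and any non-erasing morphism $\sigma:\mathcal{A}^*\to\mathcal{B}^*$, the transferred measure $\mu^\sigma=\sigma^{\mathcal{M}}(\mu)$ satisfies $$\mu^\sigma(\mathcal{B}^{\mathbb{Z}})=\sum_{a_k\in\mathcal{A}}\sum_{b_j\in\mathcal{B}}|\sigma(a_k)|_{b_j}\cdot\mu([a_k])=\sum_{a_k\in\mathcal{A}}|\sigma(a_k)|\cdot\mu([a_k]).$$ More specifically, for the vectors of letter frequencies one has the matrix equality $$\big(\mu^\sigma([b_j])\big)_{b_j\in\mathcal{B}}=M(\sigma)\cdot\big(\mu([a_k])\big)_{a_k\in\mathcal{A}}.$$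
   Context: For a finite non-empty alphabet $\mathcal{A}$, $\mathcal{A}^*$ is the free monoid of finite words, $|w|$ is word length, and $|w|_u$ is the number of (possibly overlapping) occurrences of $u$ as a factor (contiguous subword) of $w$. The full shift $\mathcal{A}^{\mathbb{Z}}$ carries the product topology and the shift $T$, $(T\mathbf{x})_k=x_{k+1}$. The cylinder of $w$ is $[w]=\{\mathbf{x}: x_1\cdots x_{|w|}=w\}$. An invariant measure is a finite $T$-invariant Borel measure; $\mathcal{M}(\mathcal{A}^{\mathbb{Z}})$ is the set of those. A monoid morphism $\sigma:\mathcal{A}^*\to\mathcal{B}^*$ is non-erasing if $|\sigma(a)|\ge1$ for all $a\in\mathcal{A}$. The incidence matrix $M(\sigma)$ has coefficient $|\sigma(a_k)|_{b_j}$ at position $(j,k)$. Measure transfer: for non-erasing $\sigma$ let $\mathcal{A}_\sigma$ be the alphabet of letters $a(k)$ with $a\in\mathcal{A}$, $1\le k\le|\sigma(a)|$; let $\pi_\sigma:\mathcal{A}^*\to\mathcal{A}_\sigma^*$, $a\mapsto a(1)a(2)\cdots a(|\sigma(a)|)$, and let $\alpha_\sigma:\mathcal{A}_\sigma^*\to\mathcal{B}^*$ send $a(k)$ to the $k$-th letter of $\sigma(a)$, so that $\sigma=\alpha_\sigma\circ\pi_\sigma$. For a non-empty word $u\in\mathcal{A}_\sigma^*$ let $\hat u\in\mathcal{A}^*$ be the shortest word such that $u$ is a factor of $\pi_\sigma(\hat u)$ (it is unique if it exists); if no such word exists, put formally $\mu([\hat u])=0$. For $\mu\in\mathcal{M}(\mathcal{A}^{\mathbb{Z}})$,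 the transferred measure $\mu^\sigma=\sigma^{\mathcal{M}}(\mu)\in\mathcal{M}(\mathcal{B}^{\mathbb{Z}})$ is the invariant measure determined by $\mu^\sigma([w])=\sum_{u\in\alpha_\sigma^{-1}(w)}\mu([\hat u])$ for all non-empty $w\in\mathcal{B}^*$. *)

theory Defs
  imports "HOL-Analysis.Analysis" "HOL-Library.Sublist"
begin

text \<open>
  Alphabets are types of class \<open>finite\<close> (hence non-empty), and words are lists.
\<close>

definition occurrences :: "'a list \<Rightarrow> 'a list \<Rightarrow> nat" where
  "occurrences u w = card {i. i + length u \<le> length w \<and> take (length u) (drop i w) = u}"

definition monoid_morphism :: "('a list \<Rightarrow> 'b list) \<Rightarrow> bool" where
  "monoid_morphism \<sigma> \<longleftrightarrow> \<sigma> [] = [] \<and> (\<forall>u v. \<sigma> (u @ v) = \<sigma> u @ \<sigma> v)"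

definition non_erasing :: "('a list \<Rightarrow> 'b list) \<Rightarrow> bool" where
  "non_erasing \<sigma> \<longleftrightarrow> (\<forall>a. length (\<sigma> [a]) \<ge> 1)"

text \<open>Rows are indexed by the letters of the target alphabet, columns by those of the source.\<close>

definition incidence_matrix :: "('a::finite list \<Rightarrow> 'b::finite list) \<Rightarrow> real ^ 'a ^ 'b" where
  "incidence_matrix \<sigma> = (\<chi> b a. real (occurrences [b] (\<sigma> [a])))"

definition shift :: "(int \<Rightarrow> 'a) \<Rightarrow> (int \<Rightarrow> 'a)" where
  "shift x = (\<lambda>k. x (k + 1))"

definition cylinder :: "'a list \<Rightarrow> (int \<Rightarrow> 'a) set" where
  "cylinder w = {x. map x [1..int (length w)] = w}"

definition shift_topology :: "(int \<Rightarrow> 'a) topology" where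
  "shift_topology = product_topology (\<lambda>_. discrete_topology UNIV) UNIV"

text \<open>
  The library's \<open>borel\<close> would need a topology attached to the type of letters by a type
  class, so the Borel sets are generated here from the open sets of \<open>shift_topology\<close>.
\<close>

definition shift_borel :: "(int \<Rightarrow> 'a) measure" where
  "shift_borel = sigma UNIV {U. openin shift_topology U}"

definition invariant_measures :: "(int \<Rightarrow> 'a) measure set" where
  "invariant_measures =
    {\<mu>. sets \<mu> = sets shift_borel \<and> finite_measure \<mu> \<and>
        (\<forall>E\<in>sets \<mu>. emeasure \<mu> (shift -` E) = emeasure \<mu> E)}"

text \<open>The letter \<open>a(k)\<close> is the pair \<open>(a, k)\<close>, with \<open>k\<close> counted from 1.\<close>

definition subdivision_alphabet :: "('a list \<Rightarrow> 'b list) \<Rightarrow> ('a \<times> nat) set" where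
  "subdivision_alphabet \<sigma> = {(a, k). 1 \<le> k \<and> k \<le> length (\<sigma> [a])}"

definition subdivision :: "('a list \<Rightarrow> 'b list) \<Rightarrow> 'a list \<Rightarrow> ('a \<times> nat) list" where
  "subdivision \<sigma> w = concat (map (\<lambda>a. map (\<lambda>k. (a, k)) [1..<Suc (length (\<sigma> [a]))]) w)"

definition relabel :: "('a list \<Rightarrow> 'b list) \<Rightarrow> ('a \<times> nat) list \<Rightarrow> 'b list" where
  "relabel \<sigma> u = map (\<lambda>(a, k). \<sigma> [a] ! (k - 1)) u"

lemma monoid_morphism_factorization:
  assumes "monoid_morphism \<sigma>"
  shows "\<sigma> w = relabel \<sigma> (subdivision \<sigma> w)"
proof (induction w)
  case Nil
  then show ?case
    using assms by (simp add: monoid_morphism_def relabel_def subdivision_def)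
next
  case (Cons a w)
  have "\<sigma> (a # w) = \<sigma> [a] @ \<sigma> w"
    using assms unfolding monoid_morphism_def by (metis append_Cons append_Nil)
  moreover have "map (\<lambda>k. \<sigma> [a] ! (k - 1)) [Suc 0..<Suc (length (\<sigma> [a]))] = \<sigma> [a]"
    by (rule nth_equalityI) (simp_all del: upt_Suc)
  ultimately show ?case
    using Cons.IH by (simp add: relabel_def subdivision_def comp_def del: upt_Suc)
qed

definition is_hat :: "('a list \<Rightarrow> 'b list) \<Rightarrow> ('a \<times> nat) list \<Rightarrow> 'a list \<Rightarrow> bool" where
  "is_hat \<sigma> u v \<longleftrightarrow> sublist u (subdivision \<sigma> v) \<and>
    (\<forall>v'. sublist u (subdivision \<sigma> v') \<longrightarrow> length v \<le> length v')"

definition hat_measure ::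
    "('a list \<Rightarrow> 'b list) \<Rightarrow> (int \<Rightarrow> 'a) measure \<Rightarrow> ('a \<times> nat) list \<Rightarrow> real" where
  "hat_measure \<sigma> \<mu> u =
    (if \<exists>v. is_hat \<sigma> u v then measure \<mu> (cylinder (THE v. is_hat \<sigma> u v)) else 0)"

definition measure_transfer ::
    "('a list \<Rightarrow> 'b list) \<Rightarrow> (int \<Rightarrow> 'a) measure \<Rightarrow> (int \<Rightarrow> 'b) measure" where
  "measure_transfer \<sigma> \<mu> =
    (THE \<nu>. \<nu> \<in> invariant_measures \<and>
      (\<forall>w. w \<noteq> [] \<longrightarrow> measure \<nu> (cylinder w) =
        (\<Sum>u\<in>{u \<in> lists (subdivision_alphabet \<sigma>). relabel \<sigma> u = w}. hat_measure \<sigma> \<mu> u)))"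

end

theory Submission
  imports Defs
begin

text \<open>
  The transferred measure is specified by its values on cylinders, so everything rests on
  knowing that exactly one invariant measure takes these values; this is
  \<open>measure_transfer_characterization\<close>. The letter frequencies are then the case \<open>w = [b]\<close> of
  the specification: the words over the subdivision alphabet that relabel to \<open>[b]\<close> are the
  single letters \<open>a(k)\<close> with \<open>b\<close> the \<open>k\<close>-th letter of \<open>\<sigma>(a)\<close>, the hat of each is \<open>a\<close>, and so
  \<open>\<mu>([a])\<close> is counted once for every occurrence of \<open>b\<close> in \<open>\<sigma>(a)\<close>. As the cylinders of the
  letters partition the shift space, summing over \<open>b\<close> gives the total mass, with
  \<open>|\<sigma>(a)|\<close> as the coefficient of \<open>\<mu>([a])\<close>.

  Uniqueness (\<open>invariant_measure_eqI\<close>): the sets that prescribe the letters in positions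
  \<open>-n, ..., n\<close> generate the Borel sets and are closed under intersection as long as the empty
  set is included. An invariant measure gives such a set the same mass as a cylinder, whose
  window starts at position \<open>1\<close>, so its values on cylinders determine it.

  Existence (\<open>suspension_measure\<close>): stack above each bi-infinite word \<open>x\<close> the floors
  \<open>1 \<le> k \<le> |\<sigma>(x\<^sub>1)|\<close> and give each floor the measure \<open>\<mu>\<close>. A point \<open>(x, k)\<close> of this tower is
  sent to the bi-infinite image of \<open>x\<close>, with position \<open>1\<close> placed at the \<open>k\<close>-th letter of
  \<open>\<sigma>(x\<^sub>1)\<close>, and the image of the measure on the tower is the required one. Shifting the image
  by one letter corresponds to climbing one floor, or, at the top of the tower, to applying the
  shift to \<open>x\<close> and returning to the ground floor; hence invariance
  (\<open>suspension_measure_invariant\<close>). For the values on cylinders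
  (\<open>suspension_measure_cylinder\<close>), the word over the subdivision alphabet that is met when
  reading \<open>|w|\<close> letters from \<open>(x, k)\<close> equals a given word \<open>u\<close> on a set which is either empty or
  the cylinder of the hat of \<open>u\<close> (\<open>itinerary_eq_iff\<close>).

  This needs an explicit form of the hat (\<open>is_hat_iff\<close>): a factor \<open>u\<close> of a subdivided word
  meets the block of its first letter and then one further block for every later letter of the
  form \<open>a(1)\<close>; reading off these blocks gives the hat.
\<close>

section \<open>Borel sets of the full shift\<close>

text \<open>
  A word whose length is not \<open>2 * n + 1\<close> is admitted and gives the empty set. The parameters
  thus range over a countable type, and the empty set belongs to the family, as stability under
  intersection requires.
\<close>

definition centred_cylinder :: "nat \<Rightarrow> 'a list \<Rightarrow> (int \<Rightarrow> 'a) set" where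
  "centred_cylinder n w = {x. map x [- int n..int n] = w}"

lemma space_shift_borel [simp]: "space shift_borel = UNIV"
  by (simp add: shift_borel_def)

text \<open>
  A basic neighbourhood constrains only finitely many coordinates, so a large enough centred
  cylinder around the point fits into it. The union is over a countable set, which is what
  makes cylinders generate the Borel sets.
\<close>

lemma open_eq_Union_centred_cylinders:
  assumes "openin shift_topology U"
  shows "U = (\<Union>(n, w)\<in>{(n, w). centred_cylinder n w \<subseteq> U}. centred_cylinder n w)"
proof (intro subset_antisym subsetI)
  fix x assume "x \<in> U"
  then obtain V where fin: "finite {i. V i \<noteq> UNIV}"
    and x: "\<forall>i. x i \<in> V i" and V: "Pi\<^sub>E UNIV V \<subseteq> U"
    using assms unfolding shift_topology_def openin_product_topology_alt
    by (fastforce simp: PiE_iff)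
  have "finite ((\<lambda>i. nat \<bar>i\<bar>) ` {i. V i \<noteq> UNIV})"
    using fin by simp
  then obtain n where n: "\<forall>m\<in>(\<lambda>i. nat \<bar>i\<bar>) ` {i. V i \<noteq> UNIV}. m \<le> n"
    using finite_nat_set_iff_bounded_le by blast
  define w where "w = map x [- int n..int n]"
  have "centred_cylinder n w \<subseteq> U"
  proof
    fix y assume "y \<in> centred_cylinder n w"
    then have eq: "y i = x i" if "- int n \<le> i" "i \<le> int n" for i
      using that by (simp add: centred_cylinder_def w_def)
    have "y i \<in> V i" for i
    proof (cases "V i = UNIV")
      case False
      then have "nat \<bar>i\<bar> \<le> n" using n by blast
      then have "y i = x i" using eq by auto
      then show ?thesis using x by simp
    qed simp
    then show "y \<in> U" using V by (auto simp: PiE_iff)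
  qed
  moreover have "x \<in> centred_cylinder n w"
    by (simp add: centred_cylinder_def w_def)
  ultimately show "x \<in> (\<Union>(n, w)\<in>{(n, w). centred_cylinder n w \<subseteq> U}. centred_cylinder n w)"
    by blast
qed blast

lemma openin_coordinate: "openin shift_topology {x. x i = a}"
proof -
  have "openin shift_topology {x \<in> topspace shift_topology. x i \<in> {a}}"
    unfolding shift_topology_def
    by (rule openin_continuous_map_preimage[OF continuous_map_product_projection])
      simp_all
  then show ?thesis by (simp add: shift_topology_def)
qed

lemma coordinate_measurable [measurable]:
  "(\<lambda>x. x i) \<in> measurable (shift_borel :: (int \<Rightarrow> 'a::finite) measure) (count_space UNIV)"
proof (subst measurable_count_space_eq2, simp, intro conjI ballI)
  fix a :: 'a
  have "{x. x i = a} \<in> sets shift_borel"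
    unfolding shift_borel_def using openin_coordinate[of i a] by (intro in_measure_of) auto
  moreover have "(\<lambda>x. x i) -` {a} \<inter> space shift_borel = {x. x i = a}" by auto
  ultimately show "(\<lambda>x. x i) -` {a} \<inter> space shift_borel \<in> sets shift_borel" by simp
qed auto

text \<open>
  The positions are an arbitrary list, so that cylinders, centred cylinders and windows at any
  place are all covered.
\<close>

lemma map_coordinates_measurable:
  assumes "\<And>i. (\<lambda>y. f y i) \<in> measurable M (count_space (UNIV :: 'a::finite set))"
  shows "{y \<in> space M. map (f y) js = w} \<in> sets M"
proof (induction js arbitrary: w)
  case (Cons i js)
  show ?case
  proof (cases w)
    case (Cons a v)
    have "{y \<in> space M. f y i = a} \<in> sets M"
      using measurable_sets[OF assms[of i], of "{a}"]
      by (simp add: vimage_def Int_def conj_commute)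
    then have "{y \<in> space M. f y i = a} \<inter> {y \<in> space M. map (f y) js = v} \<in> sets M"
      using Cons.IH by blast
    then show ?thesis by (simp add: Cons Int_def conj_ac)
  qed simp
qed simp

lemma cylinder_in_sets [measurable]:
  "cylinder w \<in> sets (shift_borel :: (int \<Rightarrow> 'a::finite) measure)"
  using map_coordinates_measurable[of "\<lambda>x. x" shift_borel "[1..int (length w)]" w]
  by (simp add: cylinder_def)

text \<open>
  The whole space is added to the generator in order that the generator contains a sequence
  exhausting the space by sets of finite measure.
\<close>

lemma sets_shift_borel_eq:
  "sets (shift_borel :: (int \<Rightarrow> 'a::finite) measure) =
     sigma_sets UNIV (insert UNIV {centred_cylinder n w | n w. True})" (is "_ = sigma_sets UNIV ?G")
proof
  have "U \<in> sigma_sets UNIV ?G" if "openin shift_topology U" for U :: "(int \<Rightarrow> 'a) set"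
  proof (subst open_eq_Union_centred_cylinders[OF that], rule sigma_sets_UNION)
    show "countable ((\<lambda>(n, w). centred_cylinder n w) ` {(n, w). centred_cylinder n w \<subseteq> U})"
      by simp
  qed auto
  then show "sets (shift_borel :: (int \<Rightarrow> 'a) measure) \<subseteq> sigma_sets UNIV ?G"
    unfolding shift_borel_def
    by (subst sets_measure_of, simp, intro sigma_sets_mono) auto
next
  have "centred_cylinder n w \<in> sets (shift_borel :: (int \<Rightarrow> 'a) measure)" for n w
    using map_coordinates_measurable[of "\<lambda>x. x" shift_borel "[- int n..int n]" w]
    by (simp add: centred_cylinder_def)
  then show "sigma_sets UNIV ?G \<subseteq> sets (shift_borel :: (int \<Rightarrow> 'a) measure)"
    using sets.sigma_sets_subset[of ?G "shift_borel :: (int \<Rightarrow> 'a) measure"]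
      sets.top[of "shift_borel :: (int \<Rightarrow> 'a) measure"] by auto
qed

lemma measurable_into_shift_borel:
  assumes "\<And>i. (\<lambda>y. f y i) \<in> measurable M (count_space (UNIV :: 'a::finite set))"
  shows "f \<in> measurable M shift_borel"
proof (rule measurable_sigma_sets[OF sets_shift_borel_eq])
  fix A :: "(int \<Rightarrow> 'a) set"
  assume "A \<in> insert UNIV {centred_cylinder n w | n w. True}"
  moreover have "f -` centred_cylinder n w \<inter> space M \<in> sets M" for n w
    using map_coordinates_measurable[OF assms, where js = "[- int n..int n]" and w = w]
    by (simp add: centred_cylinder_def vimage_def Int_def conj_commute)
  ultimately show "f -` A \<inter> space M \<in> sets M" by auto
qed auto

lemma shift_measurable [measurable]:
  "shift \<in> measurable (shift_borel :: (int \<Rightarrow> 'a::finite) measure) shift_borel"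
  by (rule measurable_into_shift_borel) (simp add: shift_def)

section \<open>Invariant measures are determined by cylinders\<close>

lemma invariant_measuresD:
  assumes "\<mu> \<in> invariant_measures"
  shows "sets \<mu> = sets shift_borel" "space \<mu> = UNIV" "finite_measure \<mu>"
    "\<And>E. E \<in> sets shift_borel \<Longrightarrow> emeasure \<mu> (shift -` E) = emeasure \<mu> E"
  using assms sets_eq_imp_space_eq[of \<mu> shift_borel]
  by (auto simp: invariant_measures_def)

definition window :: "int \<Rightarrow> 'a list \<Rightarrow> (int \<Rightarrow> 'a) set" where
  "window i w = {x. map x [i..i + int (length w) - 1] = w}"

lemma window_Nil [simp]: "window i [] = UNIV"
  by (simp add: window_def)

lemma window_Cons: "x \<in> window i (a # w) \<longleftrightarrow> x i = a \<and> x \<in> window (i + 1) w"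
  by (simp add: window_def upto_rec1 algebra_simps)

lemma window_1: "window 1 w = cylinder w"
  by (simp add: window_def cylinder_def)

lemma shift_vimage_window: "shift -` window i w = window (i + 1) w"
  by (induction w arbitrary: i) (auto simp: window_Cons set_eq_iff shift_def)

text \<open>
  Invariance moves a window by one position in either direction, hence to position \<open>1\<close>.
\<close>

lemma emeasure_window:
  fixes \<mu> :: "(int \<Rightarrow> 'a::finite) measure"
  assumes "\<mu> \<in> invariant_measures"
  shows "emeasure \<mu> (window i w) = emeasure \<mu> (cylinder w)"
proof -
  have step: "emeasure \<mu> (window (i + 1) w) = emeasure \<mu> (window i w)" for i
  proof -
    have "window i w \<in> sets shift_borel"
      using map_coordinates_measurable[of "\<lambda>x. x" shift_borel "[i..i + int (length w) - 1]" w]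
      by (simp add: window_def)
    then show ?thesis
      using invariant_measuresD(4)[OF assms] by (metis shift_vimage_window)
  qed
  have "emeasure \<mu> (window i w) = emeasure \<mu> (window 1 w)"
  proof (induction i rule: int_induct[of _ 1])
    case (step1 i) then show ?case using step by simp
  next
    case (step2 i) then show ?case using step[of "i - 1"] by simp
  qed simp
  then show ?thesis by (simp add: window_1)
qed

lemma measure_UNIV_eq_sum_letters:
  fixes \<nu> :: "(int \<Rightarrow> 'a::finite) measure"
  assumes "\<nu> \<in> invariant_measures"
  shows "measure \<nu> UNIV = (\<Sum>a\<in>UNIV. measure \<nu> (cylinder [a]))"
proof -
  interpret finite_measure \<nu> by (rule invariant_measuresD(3)[OF assms])
  have "measure \<nu> (\<Union>a\<in>UNIV. cylinder [a]) = (\<Sum>a\<in>UNIV. measure \<nu> (cylinder [a]))"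
    by (rule finite_measure_finite_Union)
      (simp_all add: invariant_measuresD(1)[OF assms] cylinder_in_sets image_subset_iff,
        auto simp: disjoint_family_on_def cylinder_def)
  moreover have "(\<Union>a\<in>UNIV. cylinder [a]) = (UNIV :: (int \<Rightarrow> 'a) set)"
    by (auto simp: cylinder_def)
  ultimately show ?thesis by simp
qed

text \<open>
  The larger of two centred windows determines the letters in the smaller one, so two centred
  cylinders are nested or disjoint.
\<close>

lemma Int_stable_centred_cylinders:
  "Int_stable (insert UNIV {centred_cylinder n w | n w. True})"
proof -
  have *: "\<exists>m v. centred_cylinder n w \<inter> centred_cylinder n' w' = centred_cylinder m v"
    if "n \<le> n'" for n n' and w w' :: "'a list"
  proof (cases "centred_cylinder n w \<inter> centred_cylinder n' w' = {}")
    case True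
    moreover have "centred_cylinder 0 ([] :: 'a list) = {}"
      by (simp add: centred_cylinder_def)
    ultimately show ?thesis by metis
  next
    case False
    then obtain x where x: "map x [- int n..int n] = w" "map x [- int n'..int n'] = w'"
      by (auto simp: centred_cylinder_def)
    have "centred_cylinder n' w' \<subseteq> centred_cylinder n w"
    proof
      fix y assume "y \<in> centred_cylinder n' w'"
      then have "\<forall>i\<in>{- int n'..int n'}. y i = x i"
        by (simp add: centred_cylinder_def flip: x(2))
      then show "y \<in> centred_cylinder n w"
        using that by (auto simp: centred_cylinder_def simp flip: x(1))
    qed
    then show ?thesis by blast
  qed
  have "\<exists>m v. centred_cylinder n w \<inter> centred_cylinder n' w' = centred_cylinder m v"
    for n n' and w w' :: "'a list"
    using *[of n n' w w'] *[of n' n w' w] by (metis Int_commute nat_le_linear)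
  then show ?thesis unfolding Int_stable_def by auto
qed

text \<open>
  The empty word is excluded, so the total mass is first recovered from the letters; on centred
  cylinders the two measures then agree by moving the window.
\<close>

lemma invariant_measure_eqI:
  fixes \<mu> \<nu> :: "(int \<Rightarrow> 'a::finite) measure"
  assumes \<mu>: "\<mu> \<in> invariant_measures" and \<nu>: "\<nu> \<in> invariant_measures"
    and eq: "\<And>w. w \<noteq> [] \<Longrightarrow> measure \<mu> (cylinder w) = measure \<nu> (cylinder w)"
  shows "\<mu> = \<nu>"
proof -
  interpret \<mu>: finite_measure \<mu> by (rule invariant_measuresD(3)[OF \<mu>])
  interpret \<nu>: finite_measure \<nu> by (rule invariant_measuresD(3)[OF \<nu>])
  have UNIV: "emeasure \<mu> UNIV = emeasure \<nu> UNIV"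
    by (simp add: \<mu>.emeasure_eq_measure \<nu>.emeasure_eq_measure
        measure_UNIV_eq_sum_letters[OF \<mu>] measure_UNIV_eq_sum_letters[OF \<nu>] eq)
  have cyl: "emeasure \<mu> (centred_cylinder n w) = emeasure \<nu> (centred_cylinder n w)" for n w
  proof (cases "length w = 2 * n + 1")
    case True
    then have "centred_cylinder n w = window (- int n) w" "w \<noteq> []"
      by (auto simp: centred_cylinder_def window_def)
    moreover have "emeasure \<mu> (cylinder w) = emeasure \<nu> (cylinder w)"
      using eq[OF \<open>w \<noteq> []\<close>] by (simp add: \<mu>.emeasure_eq_measure \<nu>.emeasure_eq_measure)
    ultimately show ?thesis
      by (simp only: emeasure_window[OF \<mu>] emeasure_window[OF \<nu>])
  next
    case False
    then have "centred_cylinder n w = {}"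
      by (auto simp: centred_cylinder_def)
    then show ?thesis by simp
  qed
  show ?thesis
  proof (rule measure_eqI_generator_eq[OF Int_stable_centred_cylinders, where \<Omega> = UNIV])
    show "range (\<lambda>_::nat. UNIV) \<subseteq> insert UNIV {centred_cylinder n w | n w. True}" by simp
  qed (use UNIV cyl \<mu>.emeasure_finite invariant_measuresD(1)[OF \<mu>] invariant_measuresD(1)[OF \<nu>]
      in \<open>auto simp: sets_shift_borel_eq\<close>)
qed

section \<open>Factors of subdivided words\<close>

text \<open>
  The successor of a letter inside a block is forced; after the last letter of a block any
  block may start.
\<close>

definition subdivision_step :: "('a list \<Rightarrow> 'b list) \<Rightarrow> 'a \<times> nat \<Rightarrow> 'a \<times> nat \<Rightarrow> bool" where
  "subdivision_step \<sigma> = (\<lambda>(a, k) (b, l).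
     if k < length (\<sigma> [a]) then b = a \<and> l = k + 1 else l = 1)"

text \<open>
  A local description of the factors of subdivided words; for a non-erasing morphism it
  describes exactly these, by \<open>factor_of_subdivision\<close> and \<open>legal_prefix_subdivision_hat\<close>.
\<close>

definition legal :: "('a list \<Rightarrow> 'b list) \<Rightarrow> ('a \<times> nat) list \<Rightarrow> bool" where
  "legal \<sigma> u \<longleftrightarrow> u \<in> lists (subdivision_alphabet \<sigma>) \<and> successively (subdivision_step \<sigma>) u"

definition block_starts :: "('a \<times> nat) list \<Rightarrow> 'a list" where
  "block_starts u = map fst (filter (\<lambda>p. snd p = 1) u)"

text \<open>
  The block containing the first letter of \<open>u\<close> is met even if \<open>u\<close> starts in its middle; every
  other block met by \<open>u\<close> is entered at its first letter.
\<close>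

definition hat_word :: "('a \<times> nat) list \<Rightarrow> 'a list" where
  "hat_word u = fst (hd u) # block_starts (tl u)"

definition block :: "('a list \<Rightarrow> 'b list) \<Rightarrow> 'a \<Rightarrow> ('a \<times> nat) list" where
  "block \<sigma> a = map (\<lambda>k. (a, k)) [1..<Suc (length (\<sigma> [a]))]"

lemma subdivision_Nil [simp]: "subdivision \<sigma> [] = []"
  by (simp add: subdivision_def)

lemma subdivision_Cons: "subdivision \<sigma> (a # v) = block \<sigma> a @ subdivision \<sigma> v"
  by (simp add: subdivision_def block_def)

lemma length_block [simp]: "length (block \<sigma> a) = length (\<sigma> [a])"
  by (simp add: block_def del: upt_Suc)

lemma nth_block: "i < length (\<sigma> [a]) \<Longrightarrow> block \<sigma> a ! i = (a, i + 1)"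
  by (simp add: block_def del: upt_Suc)

lemma block_starts_append: "block_starts (u @ v) = block_starts u @ block_starts v"
  by (simp add: block_starts_def)

lemma block_starts_block:
  assumes "non_erasing \<sigma>"
  shows "block_starts (block \<sigma> a) = [a]"
proof -
  have "\<sigma> [a] \<noteq> []" using assms by (metis non_erasing_def list.size(3) not_one_le_zero)
  then have "block \<sigma> a = (a, 1) # map (\<lambda>k. (a, k)) [2..<Suc (length (\<sigma> [a]))]"
    unfolding block_def by (subst upt_conv_Cons) (simp_all add: numeral_2_eq_2 del: upt_Suc)
  then show ?thesis
    by (simp add: block_starts_def filter_empty_conv del: upt_Suc)
qed

lemma block_starts_subdivision:
  "non_erasing \<sigma> \<Longrightarrow> block_starts (subdivision \<sigma> v) = v"
  by (induction v)
    (simp_all add: subdivision_Cons block_starts_append block_starts_block, simp add: block_starts_def)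

lemma legal_block: "legal \<sigma> (block \<sigma> a)"
  unfolding legal_def successively_conv_nth
  by (auto simp: nth_block subdivision_step_def in_set_conv_nth subdivision_alphabet_def in_lists_conv_set)

lemma hd_last_block:
  assumes "non_erasing \<sigma>"
  shows "block \<sigma> a \<noteq> []" "hd (block \<sigma> a) = (a, 1)" "last (block \<sigma> a) = (a, length (\<sigma> [a]))"
proof -
  have l: "\<sigma> [a] \<noteq> []" using assms by (metis non_erasing_def list.size(3) not_one_le_zero)
  then show ne: "block \<sigma> a \<noteq> []" by (metis length_block length_0_conv)
  show "hd (block \<sigma> a) = (a, 1)" using l ne by (simp add: hd_conv_nth nth_block)
  show "last (block \<sigma> a) = (a, length (\<sigma> [a]))" using l ne by (simp add: last_conv_nth nth_block)
qed

lemma hd_subdivision: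
  "non_erasing \<sigma> \<Longrightarrow> v \<noteq> [] \<Longrightarrow> subdivision \<sigma> v \<noteq> [] \<and> hd (subdivision \<sigma> v) = (hd v, 1)"
  by (cases v) (simp_all add: subdivision_Cons hd_last_block)

lemma legal_subdivision:
  assumes "non_erasing \<sigma>"
  shows "legal \<sigma> (subdivision \<sigma> v)"
proof (induction v)
  case (Cons a v)
  then show ?case
    using legal_block[of \<sigma> a] hd_last_block[OF assms, of a] hd_subdivision[OF assms, of v]
    by (cases "v = []")
      (auto simp: legal_def subdivision_Cons successively_append_iff subdivision_step_def)
qed (simp add: legal_def)

text \<open>
  In a legal word that starts at the beginning of a block, each letter belongs to the block
  that was started last.
\<close>

lemma last_block_starts:
  assumes "legal \<sigma> (s @ [c])" "snd (hd (s @ [c])) = 1"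
  shows "block_starts (s @ [c]) \<noteq> [] \<and> last (block_starts (s @ [c])) = fst c"
  using assms
proof (induction s arbitrary: c rule: rev_induct)
  case (snoc d s)
  then have IH: "block_starts (s @ [d]) \<noteq> []" "last (block_starts (s @ [d])) = fst d"
    and step: "subdivision_step \<sigma> d c"
    by (auto simp: legal_def successively_append_iff hd_append split: if_splits)
  show ?case
  proof (cases "snd c = 1")
    case False
    then have "fst c = fst d"
      using step by (auto simp: subdivision_step_def split: prod.splits if_splits)
    moreover have "block_starts ((s @ [d]) @ [c]) = block_starts (s @ [d])"
      using False by (simp add: block_starts_def)
    ultimately show ?thesis using IH by simp
  qed (simp add: block_starts_def)
qed (simp add: block_starts_def)

text \<open>
  The block starts of the subdivision of \<open>v\<close> spell \<open>v\<close>. The starts up to and including the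
  first letter of \<open>u\<close> end with the block of that letter, and the remaining letters of \<open>u\<close>
  contribute the rest of the hat word, so the hat word sits inside \<open>v\<close>.
\<close>

lemma factor_of_subdivision:
  assumes ne: "non_erasing \<sigma>" and u: "u \<noteq> []" "sublist u (subdivision \<sigma> v)"
  shows "legal \<sigma> u \<and> sublist (hat_word u) v"
proof -
  obtain s t where st: "subdivision \<sigma> v = s @ u @ t"
    using u(2) by (auto simp: sublist_def)
  obtain c u' where c: "u = c # u'" using u(1) by (cases u) auto
  have leg: "legal \<sigma> (s @ u @ t)" using legal_subdivision[OF ne, of v] by (simp add: st)
  then have "legal \<sigma> u" by (auto simp: legal_def successively_append_iff)
  moreover have "legal \<sigma> (s @ [c])"
    using leg by (auto simp: legal_def c successively_append_iff successively_Cons)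
  moreover have "snd (hd (s @ [c])) = 1"
    using hd_subdivision[OF ne, of v] st u(1) c by (cases v; cases s) auto
  ultimately have b: "block_starts (s @ [c]) \<noteq> []" "last (block_starts (s @ [c])) = fst c"
    using last_block_starts by blast+
  have "v = block_starts ((s @ [c]) @ u' @ t)"
    using block_starts_subdivision[OF ne, of v] by (simp add: st c)
  also have "\<dots> = block_starts (s @ [c]) @ block_starts u' @ block_starts t"
    by (simp only: block_starts_append)
  also have "\<dots> = butlast (block_starts (s @ [c])) @ hat_word u @ block_starts t"
    using b by (simp add: hat_word_def c) (metis append_butlast_last_id append.assoc append_Cons append_Nil)
  finally have "sublist (hat_word u) v" by (metis sublist_def)
  with \<open>legal \<sigma> u\<close> show ?thesis by blast
qed

text \<open>
  Conversely, a legal word runs through the blocks that it meets without skipping a letter, so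
  it is found in the subdivision of the hat word once the letters of the first block that
  precede its own first letter are dropped.
\<close>

lemma legal_prefix_subdivision_hat:
  assumes "non_erasing \<sigma>" "legal \<sigma> u" "u \<noteq> []"
  shows "prefix u (drop (snd (hd u) - 1) (subdivision \<sigma> (hat_word u)))"
  using assms(2,3)
proof (induction u)
  case (Cons c u)
  obtain a k where c: "c = (a, k)" by force
  have k: "1 \<le> k" "k \<le> length (\<sigma> [a])"
    using Cons.prems by (auto simp: legal_def subdivision_alphabet_def c)
  have drop: "drop (k - 1) (subdivision \<sigma> (a # v)) = (a, k) # drop k (subdivision \<sigma> (a # v))" for v
    using k Cons_nth_drop_Suc[of "k - 1" "block \<sigma> a"]
    by (simp add: subdivision_Cons nth_block)
  show ?case
  proof (cases u)
    case Nil
    then show ?thesis using drop[of "[]"] by (simp add: c hat_word_def block_starts_def)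
  next
    case (Cons d u')
    then have leg: "legal \<sigma> u" and step: "subdivision_step \<sigma> c d"
      using Cons.prems by (auto simp: legal_def)
    have IH: "prefix u (drop (snd d - 1) (subdivision \<sigma> (hat_word u)))"
      using Cons.IH leg Cons by simp
    show ?thesis
    proof (cases "k < length (\<sigma> [a])")
      case True
      then have "d = (a, k + 1)" using step c by (cases d) (simp add: subdivision_step_def)
      moreover have "hat_word (c # u) = hat_word u"
        using \<open>d = (a, k + 1)\<close> k by (simp add: hat_word_def Cons c block_starts_def)
      ultimately show ?thesis using IH drop
        by (simp add: c hat_word_def Cons)
    next
      case False
      then have "snd d = 1" using step c by (cases d) (simp add: subdivision_step_def)
      then have "hat_word (c # u) = a # hat_word u"
        by (simp add: hat_word_def Cons c block_starts_def)
      moreover have "k = length (\<sigma> [a])" using False k by simp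
      ultimately show ?thesis using IH drop[of "hat_word u"] \<open>snd d = 1\<close>
        by (simp add: c subdivision_Cons)
    qed
  qed
qed simp

text \<open>
  The hat word is a factor of every word whose subdivision contains \<open>u\<close>. It is therefore
  shortest, and any other shortest word, having the same length, coincides with it.
\<close>

lemma is_hat_iff:
  assumes ne: "non_erasing \<sigma>" and u: "u \<noteq> []"
  shows "is_hat \<sigma> u v \<longleftrightarrow> legal \<sigma> u \<and> v = hat_word u"
proof -
  have min: "length (hat_word u) \<le> length v'" if "sublist u (subdivision \<sigma> v')" for v'
    using factor_of_subdivision[OF ne u that] sublist_length_le by blast
  have sub: "sublist u (subdivision \<sigma> (hat_word u))" if "legal \<sigma> u"
    using legal_prefix_subdivision_hat[OF ne that u]
    by (meson prefix_imp_sublist sublist_drop sublist_order.order_trans)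
  show ?thesis
  proof
    assume h: "is_hat \<sigma> u v"
    then have "legal \<sigma> u" "sublist (hat_word u) v"
      using factor_of_subdivision[OF ne u] by (auto simp: is_hat_def)
    moreover from this have "length v \<le> length (hat_word u)"
      using h sub by (simp add: is_hat_def)
    ultimately have "v = hat_word u"
      by (auto simp: sublist_def)
    with \<open>legal \<sigma> u\<close> show "legal \<sigma> u \<and> v = hat_word u" by blast
  qed (use min sub in \<open>auto simp: is_hat_def\<close>)
qed

lemma hat_measure_eq:
  assumes "non_erasing \<sigma>" "u \<noteq> []"
  shows "hat_measure \<sigma> \<mu> u = (if legal \<sigma> u then measure \<mu> (cylinder (hat_word u)) else 0)"
proof (cases "legal \<sigma> u")
  case True
  then have "The (is_hat \<sigma> u) = hat_word u"
    by (intro the_equality) (simp_all add: is_hat_iff[OF assms])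
  then show ?thesis using True by (simp add: hat_measure_def is_hat_iff[OF assms])
qed (simp add: hat_measure_def is_hat_iff[OF assms])

section \<open>Reading the image of a bi-infinite word\<close>

text \<open>
  A position \<open>(i, k)\<close> stands for the \<open>k\<close>-th letter of the block \<open>\<sigma>(x\<^sub>i)\<close> in the bi-infinite
  image of \<open>x\<close>. Moving between positions avoids summing block lengths on both sides of the
  origin.
\<close>

definition next_pos :: "('a list \<Rightarrow> 'b list) \<Rightarrow> (int \<Rightarrow> 'a) \<Rightarrow> int \<times> nat \<Rightarrow> int \<times> nat" where
  "next_pos \<sigma> x = (\<lambda>(i, k). if k < length (\<sigma> [x i]) then (i, k + 1) else (i + 1, 1))"

definition prev_pos :: "('a list \<Rightarrow> 'b list) \<Rightarrow> (int \<Rightarrow> 'a) \<Rightarrow> int \<times> nat \<Rightarrow> int \<times> nat" where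
  "prev_pos \<sigma> x = (\<lambda>(i, k). if 1 < k then (i, k - 1) else (i - 1, length (\<sigma> [x (i - 1)])))"

text \<open>
  Index \<open>1\<close> is the starting position \<open>p\<close> itself, in keeping with cylinders, which prescribe
  letters from index \<open>1\<close> on.
\<close>

definition pos :: "('a list \<Rightarrow> 'b list) \<Rightarrow> (int \<Rightarrow> 'a) \<Rightarrow> int \<times> nat \<Rightarrow> int \<Rightarrow> int \<times> nat" where
  "pos \<sigma> x p j =
     (if 1 \<le> j then (next_pos \<sigma> x ^^ nat (j - 1)) p else (prev_pos \<sigma> x ^^ nat (1 - j)) p)"

definition reading :: "('a list \<Rightarrow> 'b list) \<Rightarrow> (int \<Rightarrow> 'a) \<Rightarrow> int \<times> nat \<Rightarrow> int \<Rightarrow> 'b" where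
  "reading \<sigma> x p j = (case pos \<sigma> x p j of (i, k) \<Rightarrow> \<sigma> [x i] ! (k - 1))"

text \<open>
  The bounds on \<open>k\<close> make \<open>prev_pos\<close> undo \<open>next_pos\<close>, which is what the indices up to \<open>0\<close> need.
\<close>

lemma reading_next_pos:
  assumes "1 \<le> k" "k \<le> length (\<sigma> [x i])"
  shows "reading \<sigma> x (next_pos \<sigma> x (i, k)) = shift (reading \<sigma> x (i, k))"
proof -
  have prev_next: "prev_pos \<sigma> x (next_pos \<sigma> x (i, k)) = (i, k)"
    using assms by (simp add: prev_pos_def next_pos_def)
  have "pos \<sigma> x (next_pos \<sigma> x (i, k)) j = pos \<sigma> x (i, k) (j + 1)" for j
  proof (cases "1 \<le> j")
    case True
    then have "nat j = Suc (nat (j - 1))" by simp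
    then show ?thesis using True by (simp add: pos_def funpow_swap1)
  next
    case False
    then have "nat (1 - j) = Suc (nat (- j))" by simp
    then show ?thesis using False prev_next
      by (simp add: pos_def funpow_Suc_right del: funpow.simps)
  qed
  then show ?thesis by (simp add: fun_eq_iff reading_def shift_def)
qed

text \<open>
  Shifting \<open>x\<close> renumbers its blocks, and renumbering commutes with both moves.
\<close>

lemma reading_shift: "reading \<sigma> (shift x) (i, k) = reading \<sigma> x (i + 1, k)"
proof -
  define h where "h = (\<lambda>(i::int, k::nat). (i + 1, k))"
  have "h (next_pos \<sigma> (shift x) p) = next_pos \<sigma> x (h p)"
    and "h (prev_pos \<sigma> (shift x) p) = prev_pos \<sigma> x (h p)" for p
    by (auto simp: h_def next_pos_def prev_pos_def shift_def split: prod.splits)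
  then have "h ((next_pos \<sigma> (shift x) ^^ n) p) = (next_pos \<sigma> x ^^ n) (h p)"
    and "h ((prev_pos \<sigma> (shift x) ^^ n) p) = (prev_pos \<sigma> x ^^ n) (h p)" for n p
    by (induction n) simp_all
  then have "pos \<sigma> x (h (i, k)) j = h (pos \<sigma> (shift x) (i, k) j)" for j
    by (simp add: pos_def)
  then show ?thesis
    by (auto simp: fun_eq_iff reading_def h_def shift_def split: prod.splits)
qed

text \<open>
  The position reached after a given number of moves takes countably many values, and each
  single move or letter depends on finitely many coordinates of \<open>x\<close>.
\<close>

lemma reading_measurable [measurable]:
  fixes \<sigma> :: "'a::finite list \<Rightarrow> 'b::finite list"
  shows "(\<lambda>x. reading \<sigma> x p) \<in> measurable shift_borel shift_borel"
proof (rule measurable_into_shift_borel)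
  fix j
  have next_meas: "(\<lambda>x. next_pos \<sigma> x q) \<in> measurable shift_borel (count_space UNIV)" for q
    unfolding next_pos_def by (cases q) simp
  have prev_meas: "(\<lambda>x. prev_pos \<sigma> x q) \<in> measurable shift_borel (count_space UNIV)" for q
    unfolding prev_pos_def by (cases q) simp
  have "(\<lambda>x. (next_pos \<sigma> x ^^ n) p) \<in> measurable shift_borel (count_space UNIV)" for n
    by (induction n) (simp_all add: measurable_compose_countable[where f = "\<lambda>q x. next_pos \<sigma> x q", OF next_meas])
  moreover have "(\<lambda>x. (prev_pos \<sigma> x ^^ n) p) \<in> measurable shift_borel (count_space UNIV)" for n
    by (induction n) (simp_all add: measurable_compose_countable[where f = "\<lambda>q x. prev_pos \<sigma> x q", OF prev_meas])
  ultimately have pos_meas: "(\<lambda>x. pos \<sigma> x p j) \<in> measurable shift_borel (count_space UNIV)"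
    by (simp add: pos_def)
  have "(\<lambda>x. case q of (i, k) \<Rightarrow> \<sigma> [x i] ! (k - 1)) \<in> measurable shift_borel (count_space UNIV)" for q
    by (cases q) simp
  from measurable_compose_countable[OF this pos_meas]
  show "(\<lambda>x. reading \<sigma> x p j) \<in> measurable shift_borel (count_space UNIV)"
    by (simp add: reading_def)
qed

text \<open>
  The word over the subdivision alphabet met on the way; relabelling it gives the letters that
  are read.
\<close>

primrec itinerary :: "('a list \<Rightarrow> 'b list) \<Rightarrow> (int \<Rightarrow> 'a) \<Rightarrow> int \<times> nat \<Rightarrow> nat \<Rightarrow> ('a \<times> nat) list" where
  "itinerary \<sigma> x p 0 = []"
| "itinerary \<sigma> x p (Suc n) = (x (fst p), snd p) # itinerary \<sigma> x (next_pos \<sigma> x p) n"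

lemma length_itinerary [simp]: "length (itinerary \<sigma> x p n) = n"
  by (induction n arbitrary: p) simp_all

lemma nth_itinerary:
  "j < n \<Longrightarrow> itinerary \<sigma> x p n ! j = (case (next_pos \<sigma> x ^^ j) p of (i, k) \<Rightarrow> (x i, k))"
proof (induction n arbitrary: p j)
  case (Suc n)
  then show ?case by (cases j) (auto simp: funpow_swap1 split: prod.splits)
qed simp

lemma relabel_itinerary:
  "relabel \<sigma> (itinerary \<sigma> x p n) = map (reading \<sigma> x p) [1..int n]"
  by (rule nth_equalityI)
    (auto simp: relabel_def nth_itinerary reading_def pos_def split: prod.splits)

lemma itinerary_in_lists:
  assumes "non_erasing \<sigma>" "1 \<le> snd p" "snd p \<le> length (\<sigma> [x (fst p)])"
  shows "itinerary \<sigma> x p n \<in> lists (subdivision_alphabet \<sigma>)"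
  using assms(2,3)
proof (induction n arbitrary: p)
  case (Suc n)
  have "1 \<le> length (\<sigma> [x (fst p + 1)])" using assms(1) by (simp add: non_erasing_def)
  then have "1 \<le> snd (next_pos \<sigma> x p)"
    "snd (next_pos \<sigma> x p) \<le> length (\<sigma> [x (fst (next_pos \<sigma> x p))])"
    by (auto simp: next_pos_def split: prod.splits)
  then show ?case using Suc by (auto simp: subdivision_alphabet_def)
qed simp

text \<open>
  Each step of the itinerary either stays in a block, where the next letter is forced, or enters
  a new one, where it reveals the next letter of \<open>x\<close>. Prescribing the itinerary thus amounts to
  prescribing the letters of \<open>x\<close> that form the hat word.
\<close>

lemma itinerary_eq_iff:
  assumes ne: "non_erasing \<sigma>" and u: "u \<noteq> []"
  shows "1 \<le> k \<and> k \<le> length (\<sigma> [x i]) \<and> itinerary \<sigma> x (i, k) (length u) = u \<longleftrightarrow>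
    legal \<sigma> u \<and> snd (hd u) = k \<and> x \<in> window i (hat_word u)"
  using u
proof (induction u arbitrary: i k)
  case (Cons c u)
  obtain a l where c: "c = (a, l)" by force
  show ?case
  proof (cases u)
    case Nil
    then show ?thesis
      by (auto simp: c legal_def subdivision_alphabet_def hat_word_def window_Cons block_starts_def)
  next
    case (Cons d u')
    obtain b m where d: "d = (b, m)" by force
    have one: "1 \<le> length (\<sigma> [x (i + 1)])" using ne by (simp add: non_erasing_def)
    have IH: "1 \<le> k \<and> k \<le> length (\<sigma> [x i]) \<and> itinerary \<sigma> x (i, k) (length u) = u \<longleftrightarrow>
      legal \<sigma> u \<and> m = k \<and> x \<in> window i (hat_word u)" for i k
      using Cons.IH Cons d by simp
    have leg: "legal \<sigma> (c # u) \<longleftrightarrow> 1 \<le> l \<and> l \<le> length (\<sigma> [a]) \<and> subdivision_step \<sigma> c d \<and> legal \<sigma> u"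
      by (auto simp: legal_def c Cons subdivision_alphabet_def)
    have win: "x \<in> window i (hat_word (c # u)) \<longleftrightarrow>
      x i = a \<and> (if m = 1 then x \<in> window (i + 1) (hat_word u) else x \<in> window (i + 1) (block_starts u'))"
      by (simp add: hat_word_def c Cons d window_Cons block_starts_def)
    have win': "x \<in> window i (hat_word u) \<longleftrightarrow> x i = b \<and> x \<in> window (i + 1) (block_starts u')" for i
      by (simp add: hat_word_def Cons d window_Cons)
    show ?thesis
    proof (cases "x i = a \<and> l = k \<and> 1 \<le> k \<and> k \<le> length (\<sigma> [a])")
      case False
      then show ?thesis unfolding leg win by (auto simp: c)
    next
      case True
      show ?thesis
      proof (cases "k < length (\<sigma> [a])")
        \<comment> \<open>The itinerary stays in its block, so \<open>u\<close> and its tail have the same hat word.\<close>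
      case less: True
        then show ?thesis
          using True IH[of "k + 1" i]
          unfolding leg win win' by (auto simp: c d next_pos_def subdivision_step_def)
      next
        case False
        then show ?thesis
          using True IH[of 1 "i + 1"] one
          unfolding leg win by (auto simp: c d next_pos_def subdivision_step_def)
      qed
    qed
  qed
qed simp

section \<open>The transferred measure as a suspension\<close>

definition max_length :: "('a::finite list \<Rightarrow> 'b list) \<Rightarrow> nat" where
  "max_length \<sigma> = Max (range (\<lambda>a. length (\<sigma> [a])))"

lemma length_le_max_length: "length (\<sigma> [a]) \<le> max_length \<sigma>"
  by (simp add: max_length_def)

definition floor_set :: "('a list \<Rightarrow> 'b list) \<Rightarrow> nat \<Rightarrow> (int \<Rightarrow> 'b) set \<Rightarrow> (int \<Rightarrow> 'a) set" where
  "floor_set \<sigma> k E = {x. k \<le> length (\<sigma> [x 1]) \<and> reading \<sigma> x (1, k) \<in> E}"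

text \<open>
  Floors above \<open>max_length \<sigma>\<close> are empty, so the finite sum collects the whole tower.
\<close>

definition suspension_measure ::
    "('a::finite list \<Rightarrow> 'b list) \<Rightarrow> (int \<Rightarrow> 'a) measure \<Rightarrow> (int \<Rightarrow> 'b) measure" where
  "suspension_measure \<sigma> \<mu> = measure_of UNIV (sets shift_borel)
     (\<lambda>E. \<Sum>k\<in>{1..max_length \<sigma>}. emeasure \<mu> (floor_set \<sigma> k E))"

lemma reading_set_measurable [measurable]:
  fixes \<sigma> :: "'a::finite list \<Rightarrow> 'b::finite list"
  assumes [measurable]: "E \<in> sets shift_borel"
  shows "{x. P (x 1) \<and> reading \<sigma> x p \<in> E} \<in> sets shift_borel"
proof -
  have "{x \<in> space shift_borel. P (x 1) \<and> reading \<sigma> x p \<in> E} \<in> sets shift_borel"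
    by measurable
  then show ?thesis by simp
qed

lemma sets_suspension_measure: "sets (suspension_measure \<sigma> \<mu>) = sets shift_borel"
  using sets.sigma_sets_eq[of shift_borel] by (simp add: suspension_measure_def)

lemma emeasure_suspension_measure:
  fixes \<sigma> :: "'a::finite list \<Rightarrow> 'b::finite list"
  assumes \<mu>: "sets \<mu> = sets shift_borel" and E: "E \<in> sets shift_borel"
  shows "emeasure (suspension_measure \<sigma> \<mu>) E =
    (\<Sum>k\<in>{1..max_length \<sigma>}. emeasure \<mu> (floor_set \<sigma> k E))"
proof (rule emeasure_measure_of[OF suspension_measure_def])
  show "sets shift_borel \<subseteq> Pow (UNIV :: (int \<Rightarrow> 'b) set)" by simp
  show "E \<in> sets (suspension_measure \<sigma> \<mu>)" using E by (simp add: sets_suspension_measure)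
  show "positive (sets (suspension_measure \<sigma> \<mu>))
     (\<lambda>E. \<Sum>k\<in>{1..max_length \<sigma>}. emeasure \<mu> (floor_set \<sigma> k E))"
    by (simp add: positive_def floor_set_def)
  show "countably_additive (sets (suspension_measure \<sigma> \<mu>))
     (\<lambda>E. \<Sum>k\<in>{1..max_length \<sigma>}. emeasure \<mu> (floor_set \<sigma> k E))"
  proof (rule countably_additiveI)
    fix A :: "nat \<Rightarrow> (int \<Rightarrow> 'b) set"
    assume A: "range A \<subseteq> sets (suspension_measure \<sigma> \<mu>)" "disjoint_family A"
    have "(\<Sum>n. emeasure \<mu> (floor_set \<sigma> k (A n))) = emeasure \<mu> (floor_set \<sigma> k (\<Union>n. A n))" for k
    proof -
      have "(\<Sum>n. emeasure \<mu> (floor_set \<sigma> k (A n))) = emeasure \<mu> (\<Union>n. floor_set \<sigma> k (A n))"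
        using A by (intro suminf_emeasure)
          (auto simp: \<mu> sets_suspension_measure disjoint_family_on_def floor_set_def
            intro!: reading_set_measurable)
      also have "(\<Union>n. floor_set \<sigma> k (A n)) = floor_set \<sigma> k (\<Union>n. A n)"
        by (auto simp: floor_set_def)
      finally show ?thesis .
    qed
    then show "(\<Sum>n. \<Sum>k\<in>{1..max_length \<sigma>}. emeasure \<mu> (floor_set \<sigma> k (A n))) =
      (\<Sum>k\<in>{1..max_length \<sigma>}. emeasure \<mu> (floor_set \<sigma> k (\<Union>n. A n)))"
      by (subst suminf_sum) simp_all
  qed
qed

text \<open>
  Write \<open>R k\<close> for the points at the top of a tower of height \<open>k\<close> whose reading, taken from the
  ground floor above the next letter, lies in \<open>E\<close>. The preimage of \<open>E\<close> on floor \<open>k\<close> consists of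
  the points that climb into \<open>E\<close> on floor \<open>k + 1\<close>, together with \<open>R k\<close>. Summed over \<open>k\<close>, the
  first kind accounts for all floors but the lowest. The sets \<open>R k\<close> partition the preimage under
  the shift of the lowest floor, so by invariance of \<open>\<mu>\<close> they account for the lowest floor.
\<close>

lemma suspension_measure_invariant:
  fixes \<sigma> :: "'a::finite list \<Rightarrow> 'b::finite list"
  assumes \<mu>: "\<mu> \<in> invariant_measures" and ne: "non_erasing \<sigma>"
  shows "suspension_measure \<sigma> \<mu> \<in> invariant_measures"
proof -
  interpret finite_measure \<mu> by (rule invariant_measuresD(3)[OF \<mu>])
  note sets_\<mu> = invariant_measuresD(1)[OF \<mu>]
  let ?L = "max_length \<sigma>"
  let ?\<nu> = "suspension_measure \<sigma> \<mu>"
  have one: "1 \<le> length (\<sigma> [a])" for a using ne by (simp add: non_erasing_def)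
  have "1 \<le> ?L" using one length_le_max_length le_trans by blast
  have inv: "emeasure ?\<nu> (shift -` E) = emeasure ?\<nu> E" if E [measurable]: "E \<in> sets shift_borel" for E
  proof -
    define R where "R k = {x. k = length (\<sigma> [x 1]) \<and> reading \<sigma> x (2, 1) \<in> E}" for k
    have R: "R k \<in> sets \<mu>" for k
      unfolding R_def sets_\<mu> by (rule reading_set_measurable[OF E])
    have floor: "floor_set \<sigma> k E \<in> sets \<mu>" for k
      unfolding floor_set_def sets_\<mu> by (rule reading_set_measurable[OF E])
    have split: "floor_set \<sigma> k (shift -` E) = floor_set \<sigma> (k + 1) E \<union> R k" if "1 \<le> k" for k
    proof (rule set_eqI)
      fix x
      show "x \<in> floor_set \<sigma> k (shift -` E) \<longleftrightarrow> x \<in> floor_set \<sigma> (k + 1) E \<union> R k"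
        using reading_next_pos[of k \<sigma> x 1] that
        by (cases "k < length (\<sigma> [x 1])"; cases "k = length (\<sigma> [x 1])")
          (auto simp: floor_set_def R_def next_pos_def)
    qed
    have "(\<Sum>k\<in>{1..?L}. emeasure \<mu> (R k)) = emeasure \<mu> (\<Union>k\<in>{1..?L}. R k)"
      using R by (intro sum_emeasure) (auto simp: disjoint_family_on_def R_def)
    also have "(\<Union>k\<in>{1..?L}. R k) = shift -` floor_set \<sigma> 1 E"
      using one length_le_max_length[of \<sigma>] reading_shift[of \<sigma> _ 1 1]
      by (auto simp: R_def floor_set_def)
    also have "emeasure \<mu> \<dots> = emeasure \<mu> (floor_set \<sigma> 1 E)"
      using invariant_measuresD(4)[OF \<mu>] floor sets_\<mu> by auto
    finally have R_sum: "(\<Sum>k\<in>{1..?L}. emeasure \<mu> (R k)) = emeasure \<mu> (floor_set \<sigma> 1 E)" .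
    \<comment> \<open>Climbing out of the highest floor is impossible, so one summand disappears.\<close>
    have top: "floor_set \<sigma> (Suc ?L) E = {}"
      using length_le_max_length[of \<sigma>] by (auto simp: floor_set_def not_less_eq_eq[symmetric])
    have "shift -` E \<in> sets shift_borel"
      using measurable_sets[OF shift_measurable E] by simp
    then have "emeasure ?\<nu> (shift -` E) = (\<Sum>k\<in>{1..?L}. emeasure \<mu> (floor_set \<sigma> k (shift -` E)))"
      by (rule emeasure_suspension_measure[OF sets_\<mu>])
    also have "\<dots> = (\<Sum>k\<in>{1..?L}. emeasure \<mu> (floor_set \<sigma> (k + 1) E) + emeasure \<mu> (R k))"
    proof (rule sum.cong)
      fix k assume "k \<in> {1..?L}"
      then show "emeasure \<mu> (floor_set \<sigma> k (shift -` E)) =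
        emeasure \<mu> (floor_set \<sigma> (k + 1) E) + emeasure \<mu> (R k)"
        using floor R split by (subst plus_emeasure) (auto simp: floor_set_def R_def)
    qed simp
    also have "\<dots> = (\<Sum>k\<in>{1..?L}. emeasure \<mu> (floor_set \<sigma> (Suc k) E)) + emeasure \<mu> (floor_set \<sigma> 1 E)"
      by (simp only: sum.distrib R_sum Suc_eq_plus1)
    also have "(\<Sum>k\<in>{1..?L}. emeasure \<mu> (floor_set \<sigma> (Suc k) E)) =
      (\<Sum>k\<in>{Suc 1..Suc ?L}. emeasure \<mu> (floor_set \<sigma> k E))"
      by (rule sum.shift_bounds_cl_Suc_ivl[symmetric])
    also have "\<dots> = (\<Sum>k\<in>{Suc 1..?L}. emeasure \<mu> (floor_set \<sigma> k E))"
      using \<open>1 \<le> ?L\<close> by (simp add: top)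
    also have "\<dots> + emeasure \<mu> (floor_set \<sigma> 1 E) = (\<Sum>k\<in>{1..?L}. emeasure \<mu> (floor_set \<sigma> k E))"
      using \<open>1 \<le> ?L\<close> by (simp add: sum.atLeast_Suc_atMost add.commute)
    also have "\<dots> = emeasure ?\<nu> E"
      by (rule emeasure_suspension_measure[OF sets_\<mu> E, symmetric])
    finally show ?thesis .
  qed
  have "finite_measure ?\<nu>"
  proof
    have "space ?\<nu> = UNIV"
      using sets_eq_imp_space_eq[OF sets_suspension_measure] by simp
    then show "emeasure ?\<nu> (space ?\<nu>) \<noteq> \<infinity>"
      using emeasure_suspension_measure[OF sets_\<mu>, of UNIV \<sigma>]
        sets.top[of "shift_borel :: (int \<Rightarrow> 'b) measure"] by simp
  qed
  then show ?thesis
    using inv by (auto simp: invariant_measures_def sets_suspension_measure)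
qed

lemma finite_relabel_preimage:
  fixes \<sigma> :: "'a::finite list \<Rightarrow> 'b list"
  shows "finite {u \<in> lists (subdivision_alphabet \<sigma>). relabel \<sigma> u = w}"
proof (rule finite_subset)
  have "subdivision_alphabet \<sigma> \<subseteq> UNIV \<times> {1..max_length \<sigma>}"
    using length_le_max_length[of \<sigma>] by (fastforce simp: subdivision_alphabet_def intro: le_trans)
  then show "finite {u. set u \<subseteq> subdivision_alphabet \<sigma> \<and> length u = length w}"
    by (intro finite_lists_length_eq) (rule finite_subset, auto)
qed (auto simp: relabel_def)

text \<open>
  On floor \<open>k\<close> the points reading \<open>w\<close> are sorted by their itinerary \<open>u\<close>, which relabels to \<open>w\<close>
  and starts with a letter of index \<open>k\<close>. The points with itinerary \<open>u\<close> form the cylinder of the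
  hat of \<open>u\<close>, or the empty set if \<open>u\<close> has no hat. Each \<open>u\<close> in the preimage of \<open>w\<close> occurs on
  exactly one floor.
\<close>

lemma suspension_measure_cylinder:
  fixes \<sigma> :: "'a::finite list \<Rightarrow> 'b::finite list"
  assumes \<mu>: "\<mu> \<in> invariant_measures" and ne: "non_erasing \<sigma>" and w: "w \<noteq> []"
  shows "measure (suspension_measure \<sigma> \<mu>) (cylinder w) =
    (\<Sum>u\<in>{u \<in> lists (subdivision_alphabet \<sigma>). relabel \<sigma> u = w}. hat_measure \<sigma> \<mu> u)"
proof -
  interpret finite_measure \<mu> by (rule invariant_measuresD(3)[OF \<mu>])
  note sets_\<mu> = invariant_measuresD(1)[OF \<mu>]
  let ?K = "{1..max_length \<sigma>}"
  define U where "U = {u \<in> lists (subdivision_alphabet \<sigma>). relabel \<sigma> u = w}"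
  define Uk where "Uk k = {u \<in> U. snd (hd u) = k}" for k
  define H where "H u = (if legal \<sigma> u then cylinder (hat_word u) else {})" for u
  have fin: "finite U" unfolding U_def by (rule finite_relabel_preimage)
  have len: "length u = length w" "u \<noteq> []" if "u \<in> U" for u
    using that w by (auto simp: U_def relabel_def)
  have H: "x \<in> H u \<longleftrightarrow> k \<le> length (\<sigma> [x 1]) \<and> itinerary \<sigma> x (1, k) (length w) = u"
    if "u \<in> Uk k" "1 \<le> k" for x u k
    using itinerary_eq_iff[OF ne, of u k x 1] that len[of u]
    by (auto simp: H_def Uk_def window_1)
  have floor: "emeasure \<mu> (floor_set \<sigma> k (cylinder w)) = (\<Sum>u\<in>Uk k. ennreal (hat_measure \<sigma> \<mu> u))"
    if k: "k \<in> ?K" for k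
  proof -
    have "floor_set \<sigma> k (cylinder w) = (\<Union>u\<in>Uk k. H u)"
    proof (intro set_eqI iffI)
      fix x assume x: "x \<in> floor_set \<sigma> k (cylinder w)"
      let ?u = "itinerary \<sigma> x (1, k) (length w)"
      have "relabel \<sigma> ?u = w" "?u \<in> lists (subdivision_alphabet \<sigma>)"
        using x k itinerary_in_lists[OF ne, of "(1, k)" x]
        by (auto simp: floor_set_def cylinder_def relabel_itinerary)
      moreover have "snd (hd ?u) = k" using w by (cases w) auto
      ultimately have "?u \<in> Uk k" by (simp add: Uk_def U_def)
      moreover have "x \<in> H ?u" using H[OF \<open>?u \<in> Uk k\<close>] x k by (auto simp: floor_set_def)
      ultimately show "x \<in> (\<Union>u\<in>Uk k. H u)" by blast
    next
      fix x assume "x \<in> (\<Union>u\<in>Uk k. H u)"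
      then obtain u where u: "u \<in> Uk k" "x \<in> H u" by blast
      then have "k \<le> length (\<sigma> [x 1])" "itinerary \<sigma> x (1, k) (length w) = u"
        using H[OF u(1)] k by auto
      moreover have "relabel \<sigma> u = w" using u(1) by (simp add: Uk_def U_def)
      ultimately show "x \<in> floor_set \<sigma> k (cylinder w)"
        by (simp add: floor_set_def cylinder_def relabel_itinerary[symmetric])
    qed
    also have "emeasure \<mu> \<dots> = (\<Sum>u\<in>Uk k. emeasure \<mu> (H u))"
    proof (rule sum_emeasure[symmetric])
      show "disjoint_family_on H (Uk k)"
        using H k by (fastforce simp: disjoint_family_on_def)
      show "H ` Uk k \<subseteq> sets \<mu>"
        by (simp add: sets_\<mu> H_def image_subset_iff cylinder_in_sets)
      show "finite (Uk k)"
        using fin by (simp add: Uk_def)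
    qed
    also have "\<dots> = (\<Sum>u\<in>Uk k. ennreal (hat_measure \<sigma> \<mu> u))"
    proof (rule sum.cong)
      fix u assume "u \<in> Uk k"
      then have "u \<noteq> []" using len(2) by (simp add: Uk_def)
      then show "emeasure \<mu> (H u) = ennreal (hat_measure \<sigma> \<mu> u)"
        by (simp add: H_def hat_measure_eq[OF ne] emeasure_eq_measure)
    qed simp
    finally show ?thesis .
  qed
  have nonneg: "0 \<le> hat_measure \<sigma> \<mu> u" for u by (simp add: hat_measure_def)
  have range: "(\<lambda>u. snd (hd u)) ` U \<subseteq> ?K"
  proof (intro image_subsetI)
    fix u assume u: "u \<in> U"
    then have "hd u \<in> subdivision_alphabet \<sigma>"
      using len[OF u] hd_in_set[of u] by (auto simp: U_def in_lists_conv_set)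
    then show "snd (hd u) \<in> ?K"
      using length_le_max_length[of \<sigma> "fst (hd u)"] by (auto simp: subdivision_alphabet_def)
  qed
  have "emeasure (suspension_measure \<sigma> \<mu>) (cylinder w) =
      (\<Sum>k\<in>?K. emeasure \<mu> (floor_set \<sigma> k (cylinder w)))"
    by (rule emeasure_suspension_measure[OF sets_\<mu> cylinder_in_sets])
  also have "\<dots> = (\<Sum>k\<in>?K. \<Sum>u\<in>Uk k. ennreal (hat_measure \<sigma> \<mu> u))"
    by (intro sum.cong refl floor)
  also have "\<dots> = (\<Sum>u\<in>U. ennreal (hat_measure \<sigma> \<mu> u))"
    unfolding Uk_def by (rule sum.group[OF fin _ range]) simp
  also have "\<dots> = ennreal (\<Sum>u\<in>U. hat_measure \<sigma> \<mu> u)"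
    by (rule sum_ennreal[OF nonneg])
  finally show ?thesis
    by (simp add: measure_def U_def sum_nonneg nonneg)
qed

lemma measure_transfer_characterization:
  fixes \<sigma> :: "'a::finite list \<Rightarrow> 'b::finite list"
  assumes \<mu>: "\<mu> \<in> invariant_measures" and ne: "non_erasing \<sigma>"
  shows "measure_transfer \<sigma> \<mu> \<in> invariant_measures"
    and "w \<noteq> [] \<Longrightarrow> measure (measure_transfer \<sigma> \<mu>) (cylinder w) =
      (\<Sum>u\<in>{u \<in> lists (subdivision_alphabet \<sigma>). relabel \<sigma> u = w}. hat_measure \<sigma> \<mu> u)"
proof -
  have "measure_transfer \<sigma> \<mu> = suspension_measure \<sigma> \<mu>"
    unfolding measure_transfer_def
    by (rule the_equality)
      (auto intro!: invariant_measure_eqI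
        simp: suspension_measure_invariant[OF \<mu> ne] suspension_measure_cylinder[OF \<mu> ne])
  then show "measure_transfer \<sigma> \<mu> \<in> invariant_measures"
    and "w \<noteq> [] \<Longrightarrow> measure (measure_transfer \<sigma> \<mu>) (cylinder w) =
      (\<Sum>u\<in>{u \<in> lists (subdivision_alphabet \<sigma>). relabel \<sigma> u = w}. hat_measure \<sigma> \<mu> u)"
    by (simp_all add: suspension_measure_invariant[OF \<mu> ne] suspension_measure_cylinder[OF \<mu> ne])
qed

section \<open>Letter frequencies\<close>

lemma occurrences_letter: "occurrences [b] w = card {i. i < length w \<and> w ! i = b}"
proof -
  have "i + length [b] \<le> length w \<and> take (length [b]) (drop i w) = [b] \<longleftrightarrow> i < length w \<and> w ! i = b" for i
    by (cases "i < length w") (simp_all add: take_Suc hd_drop_conv_nth Suc_le_eq)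
  then show ?thesis by (simp add: occurrences_def)
qed

lemma sum_occurrences_letters:
  "(\<Sum>b\<in>UNIV. occurrences [b :: 'b::finite] w) = length w"
proof -
  have "(\<Sum>b\<in>UNIV. occurrences [b] w) = card (\<Union>b\<in>UNIV. {i. i < length w \<and> w ! i = b})"
    unfolding occurrences_letter by (rule card_UN_disjoint[symmetric]) auto
  also have "(\<Union>b\<in>UNIV. {i. i < length w \<and> w ! i = b}) = {..<length w}" by auto
  finally show ?thesis by simp
qed

text \<open>
  A letter of the subdivision alphabet is its own one-letter itinerary, and its hat is the letter
  it was cut from. The index of \<open>a(k)\<close> counts from \<open>1\<close> and positions in a list from \<open>0\<close>, whence
  the shift by one in the bijection.
\<close>

lemma measure_transfer_letter:
  fixes \<sigma> :: "'a::finite list \<Rightarrow> 'b::finite list"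
  assumes \<mu>: "\<mu> \<in> invariant_measures" and ne: "non_erasing \<sigma>"
  shows "measure (measure_transfer \<sigma> \<mu>) (cylinder [b]) =
    (\<Sum>a\<in>UNIV. real (occurrences [b] (\<sigma> [a])) * measure \<mu> (cylinder [a]))"
proof -
  let ?I = "\<lambda>a. {i. i < length (\<sigma> [a]) \<and> \<sigma> [a] ! i = b}"
  have "measure (measure_transfer \<sigma> \<mu>) (cylinder [b]) =
      (\<Sum>u\<in>{u \<in> lists (subdivision_alphabet \<sigma>). relabel \<sigma> u = [b]}. hat_measure \<sigma> \<mu> u)"
    by (simp add: measure_transfer_characterization(2)[OF \<mu> ne])
  also have "\<dots> = (\<Sum>(a, i)\<in>Sigma UNIV ?I. measure \<mu> (cylinder [a]))"
  proof (rule sum.reindex_bij_witness[where i = "\<lambda>(a, i). [(a, i + 1)]"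
        and j = "\<lambda>u. (fst (hd u), snd (hd u) - 1)"], goal_cases)
    case (5 u)
    then obtain a k where u: "u = [(a, k)]" "legal \<sigma> u"
      by (auto simp: relabel_def map_eq_Cons_conv legal_def)
    then show ?case
      by (simp add: hat_measure_eq[OF ne] hat_word_def block_starts_def)
  qed (auto simp: relabel_def map_eq_Cons_conv subdivision_alphabet_def)
  also have "\<dots> = (\<Sum>a\<in>UNIV. \<Sum>i\<in>?I a. measure \<mu> (cylinder [a]))"
    by (rule sum.Sigma[symmetric]) auto
  also have "\<dots> = (\<Sum>a\<in>UNIV. real (occurrences [b] (\<sigma> [a])) * measure \<mu> (cylinder [a]))"
    by (simp add: occurrences_letter)
  finally show ?thesis .
qed

theorem proposition1p3:
  fixes \<mu> :: "(int \<Rightarrow> 'a::finite) measure"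
    and \<sigma> :: "'a list \<Rightarrow> 'b::finite list"
  assumes "\<mu> \<in> invariant_measures"
    and "monoid_morphism \<sigma>"
    and "non_erasing \<sigma>"
  shows "measure (measure_transfer \<sigma> \<mu>) (UNIV :: (int \<Rightarrow> 'b) set) =
           (\<Sum>a\<in>UNIV. \<Sum>b\<in>UNIV. real (occurrences [b] (\<sigma> [a])) * measure \<mu> (cylinder [a])) \<and>
         (\<Sum>a\<in>UNIV. \<Sum>b\<in>UNIV. real (occurrences [b] (\<sigma> [a])) * measure \<mu> (cylinder [a])) =
           (\<Sum>a\<in>UNIV. real (length (\<sigma> [a])) * measure \<mu> (cylinder [a])) \<and>
         (\<chi> b. measure (measure_transfer \<sigma> \<mu>) (cylinder [b])) =
           incidence_matrix \<sigma> *v (\<chi> a. measure \<mu> (cylinder [a]))"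
proof (intro conjI)
  note letter = measure_transfer_letter[OF assms(1,3)]
  show "measure (measure_transfer \<sigma> \<mu>) UNIV =
      (\<Sum>a\<in>UNIV. \<Sum>b\<in>UNIV. real (occurrences [b] (\<sigma> [a])) * measure \<mu> (cylinder [a]))"
    unfolding measure_UNIV_eq_sum_letters[OF measure_transfer_characterization(1)[OF assms(1,3)]] letter
    by (rule sum.swap)
  show "(\<Sum>a\<in>UNIV. \<Sum>b\<in>UNIV. real (occurrences [b] (\<sigma> [a])) * measure \<mu> (cylinder [a])) =
      (\<Sum>a\<in>UNIV. real (length (\<sigma> [a])) * measure \<mu> (cylinder [a]))"
    by (simp only: sum_distrib_right[symmetric] of_nat_sum[symmetric] sum_occurrences_letters)
  show "(\<chi> b. measure (measure_transfer \<sigma> \<mu>) (cylinder [b])) =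
      incidence_matrix \<sigma> *v (\<chi> a. measure \<mu> (cylinder [a]))"
    by (simp add: vec_eq_iff incidence_matrix_def matrix_vector_mult_def letter)
qed

end
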